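(* Let $V$ be an infinite set. The construction $R\mapsto\Delta_R$ defines a bijection from the context structures on $V$ to the structure categories, where $\Delta_R$ consists of those functions $\theta\colon[m]\to[n]$ between finite ordinals such that $c_1\cdots c_n\,R\,c_{\theta(1)}\cdots c_{\theta(m)}$ for a context $c=c_1\cdots c_n$ with $c_1,\dots,c_n\in V$.
   Context: $[n]=\{1,\dots,n\}$ for $n\in\mathbb N$ ($0\in\mathbb N$); $\mathbf{FinOrd}$ is the category of the sets $[n]$ and all functions. For $f_i\colon[m_i]\to[n_i]$ ($i\le k$), the coproduct $f_1+\dots+f_k\colon[M_k]\to[N_k]$ sends $M_{i-1}+x\mapsto N_{i-1}+f_i(x)$ for $0<x\le m_i$, where $M_i=\sum_{j\le i}m_j$, $N_i=\sum_{j\le i}n_j$. For $\theta\colon[m]\to[n]$ and $k_1,\dots,k_n\in\mathbb N$, the similarity component $\theta'_{k_1,\dots,k_n}\colon[k_{\theta(1)}+\dots+k_{\theta(m)}]\to[k_1+\dots+k_n]$ sends $L_{i-1}+x\mapsto K_{\theta(i)-1}+x$ for $0<x\le k_{\theta(i)}$, where $L_i=k_{\theta(1)}+\dots+k_{\theta(i)}$ and $K_j=k_1+\dots+k_j$. A structure category is a wide subcategory $\Delta$ of $\mathbf{FinOrd}$ (containing all objects) closed under coproducts of morphisms and such that if $\theta\colon[m]\to[n]$ is in $\Delta$ then $\theta'_{k_1,\dots,k_n}$ is in $\Delta$ for all $k_1,\dots,k_n\in\mathbb N$. For a set $V$, $V^*$ is the set of finite words in $V$; a context is a word with no repeated letter;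 $\mathcal C$ is the set of contexts; $\mathrm{Var}(v)$ is the set of letters of $v$. A context structure on $V$ is a relation $R\subset\mathcal C\times V^*$ with: (1) $cRc$ for every $c\in\mathcal C$; (2) $cRv$ implies $\mathrm{Var}(v)\subset\mathrm{Var}(c)$; (3) $cRv^1\cdots v^n$ and $v^iRw^i$ for $i\le n$ imply $cRw^1\cdots w^n$; (4) if $cRv$, $s\colon\mathrm{Var}(c)\to V^*$ and $dRs(c)$, then $dRs(v)$, where $s(v_1\cdots v_n)=s(v_1)\cdots s(v_n)$ (concatenation). *)

theory Defs
  imports Main "HOL-Library.FuncSet"
begin

text \<open>
  A morphism \<open>f : [m] \<rightarrow> [n]\<close> of FinOrd is the triple \<open>(m, n, f)\<close>, where \<open>f\<close> is extensional
  (\<open>undefined\<close> outside \<open>[m] = {1..m}\<close>), so that equality of triples is equality of morphisms.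
\<close>

type_synonym morphism = "nat \<times> nat \<times> (nat \<Rightarrow> nat)"

definition FinOrd :: "morphism set" where
  "FinOrd = {(m, n, f). f \<in> {1..m} \<rightarrow>\<^sub>E {1..n}}"

text \<open>Finite families are indexed from 1; their values outside the index range are irrelevant.\<close>

definition psum :: "(nat \<Rightarrow> nat) \<Rightarrow> nat \<Rightarrow> nat" where
  "psum k i = (\<Sum>j = 1..i. k j)"

text \<open>
  The index \<open>i\<close> of the block containing position \<open>y\<close>, that is, with
  \<open>psum m (i - 1) < y \<le> psum m i\<close> for \<open>y \<ge> 1\<close>. It is only used for \<open>y\<close> up to the total length,
  where it agrees with the paper's decomposition \<open>y = psum m (i - 1) + x\<close>, \<open>0 < x \<le> m i\<close>;
  see \<open>block_eq\<close> and the two \<open>_apply\<close> lemmas.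
\<close>

definition block :: "(nat \<Rightarrow> nat) \<Rightarrow> nat \<Rightarrow> nat" where
  "block m y = (LEAST i. y \<le> psum m i)"

definition coproduct ::
    "nat \<Rightarrow> (nat \<Rightarrow> nat) \<Rightarrow> (nat \<Rightarrow> nat) \<Rightarrow> (nat \<Rightarrow> nat \<Rightarrow> nat) \<Rightarrow> nat \<Rightarrow> nat" where
  "coproduct k m n f = (\<lambda>y\<in>{1..psum m k}.
     let i = block m y in psum n (i - 1) + f i (y - psum m (i - 1)))"

definition similarity :: "nat \<Rightarrow> (nat \<Rightarrow> nat) \<Rightarrow> (nat \<Rightarrow> nat) \<Rightarrow> nat \<Rightarrow> nat" where
  "similarity m \<theta> k = (\<lambda>y\<in>{1..psum (k \<circ> \<theta>) m}.
     let i = block (k \<circ> \<theta>) y in psum k (\<theta> i - 1) + (y - psum (k \<circ> \<theta>) (i - 1)))"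

definition structure_category :: "morphism set \<Rightarrow> bool" where
  "structure_category D \<longleftrightarrow>
     D \<subseteq> FinOrd \<and>
     (\<forall>n. (n, n, \<lambda>x\<in>{1..n}. x) \<in> D) \<and>
     (\<forall>l m n f g. (l, m, f) \<in> D \<longrightarrow> (m, n, g) \<in> D \<longrightarrow> (l, n, compose {1..l} g f) \<in> D) \<and>
     (\<forall>k m n f. (\<forall>i\<in>{1..k}. (m i, n i, f i) \<in> D) \<longrightarrow>
        (psum m k, psum n k, coproduct k m n f) \<in> D) \<and>
     (\<forall>m n \<theta> k. (m, n, \<theta>) \<in> D \<longrightarrow>
        (psum (k \<circ> \<theta>) m, psum k n, similarity m \<theta> k) \<in> D)"

definition contexts :: "'a set \<Rightarrow> 'a list set" where
  "contexts V = {c \<in> lists V. distinct c}"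

text \<open>
  In the last clause \<open>s\<close> is a total function constrained only on the letters of \<open>c\<close>;
  by the second clause these include all letters of \<open>v\<close>.
\<close>

definition context_structure :: "'a set \<Rightarrow> ('a list \<times> 'a list) set \<Rightarrow> bool" where
  "context_structure V R \<longleftrightarrow>
     R \<subseteq> contexts V \<times> lists V \<and>
     (\<forall>c\<in>contexts V. (c, c) \<in> R) \<and>
     (\<forall>c v. (c, v) \<in> R \<longrightarrow> set v \<subseteq> set c) \<and>
     (\<forall>c vs ws. (c, concat vs) \<in> R \<longrightarrow> list_all2 (\<lambda>v w. (v, w) \<in> R) vs ws \<longrightarrow>
        (c, concat ws) \<in> R) \<and>
     (\<forall>c v d s. (c, v) \<in> R \<longrightarrow> s \<in> set c \<rightarrow> lists V \<longrightarrow> (d, concat (map s c)) \<in> R \<longrightarrow>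
        (d, concat (map s v)) \<in> R)"

text \<open>Lists are indexed from 0, so the letter \<open>c\<^sub>i\<close> of the context \<open>c = c\<^sub>1 \<dots> c\<^sub>n\<close> is \<open>c ! (i - 1)\<close>.\<close>

definition Delta :: "'a set \<Rightarrow> ('a list \<times> 'a list) set \<Rightarrow> morphism set" where
  "Delta V R = {(m, n, \<theta>). (m, n, \<theta>) \<in> FinOrd \<and>
     (\<exists>c\<in>contexts V. length c = n \<and> (c, map (\<lambda>i. c ! (\<theta> i - 1)) [1..<Suc m]) \<in> R)}"

lemma psum_mono: "i \<le> j \<Longrightarrow> psum k i \<le> psum k j"
  unfolding psum_def by (rule sum_mono2) auto

lemma psum_step: "1 \<le> i \<Longrightarrow> psum k i = psum k (i - 1) + k i"
  unfolding psum_def by (cases i) auto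

lemma block_eq:
  assumes "1 \<le> i" "0 < x" "x \<le> m i"
  shows "block m (psum m (i - 1) + x) = i"
  unfolding block_def
proof (rule Least_equality)
  show "psum m (i - 1) + x \<le> psum m i"
    using assms psum_step[of i m] by simp
next
  fix j assume j: "psum m (i - 1) + x \<le> psum m j"
  show "i \<le> j"
  proof (rule ccontr)
    assume "\<not> i \<le> j"
    then have "psum m j \<le> psum m (i - 1)" by (intro psum_mono) simp
    with j assms show False by simp
  qed
qed

lemma position_in_range:
  assumes "i \<in> {1..k}" "0 < x" "x \<le> m i"
  shows "psum m (i - 1) + x \<in> {1..psum m k}"
  using assms psum_step[of i m] psum_mono[of i k m] by auto

lemma coproduct_apply:
  assumes "i \<in> {1..k}" "0 < x" "x \<le> m i"
  shows "coproduct k m n f (psum m (i - 1) + x) = psum n (i - 1) + f i x"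
  using assms block_eq[of i x m] position_in_range[of i k x m]
  by (simp add: coproduct_def)

lemma similarity_apply:
  assumes "i \<in> {1..m}" "0 < x" "x \<le> k (\<theta> i)"
  shows "similarity m \<theta> k (psum (k \<circ> \<theta>) (i - 1) + x) = psum k (\<theta> i - 1) + x"
  using assms block_eq[of i x "k \<circ> \<theta>"] position_in_range[of i m x "k \<circ> \<theta>"]
  by (simp add: similarity_def)

end

theory Submission imports Defs begin

text \<open>
  A pair \<open>c R v\<close> is the same thing as a context \<open>c\<close> together with the function
  \<open>\<theta> : [|v|] \<rightarrow> [|c|]\<close> that reads off \<open>v\<close> from \<open>c\<close>. By substitution, \<open>R\<close> does not see which context
  is used, so \<open>R\<close> is determined by \<open>\<Delta>\<^sub>R\<close>. Under this dictionary clause (3) corresponds to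
  precomposition with a coproduct, and clause (4) to precomposition with a similarity component.
\<close>

section \<open>Words read off along functions\<close>

text \<open>The element type is arbitrary because \<open>c\<close> will also be a word with
  repetitions or a list of words. Values of \<open>\<theta>\<close> count from 1 and list positions
  from 0, hence the subtraction.\<close>

definition reindex :: "'b list \<Rightarrow> nat \<Rightarrow> (nat \<Rightarrow> nat) \<Rightarrow> 'b list" where
  "reindex c m \<theta> = map (\<lambda>i. c ! (\<theta> i - 1)) [1..<Suc m]"

lemma length_reindex [simp]: "length (reindex c m \<theta>) = m"
  by (simp add: reindex_def)

lemma nth_reindex: "j < m \<Longrightarrow> reindex c m \<theta> ! j = c ! (\<theta> (Suc j) - 1)"
  by (simp add: reindex_def del: upt_Suc)

lemma set_reindex:
  assumes "\<theta> \<in> {1..m} \<rightarrow> {1..length c}"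
  shows "set (reindex c m \<theta>) \<subseteq> set c"
proof
  fix x assume "x \<in> set (reindex c m \<theta>)"
  then obtain i where i: "i \<in> set [1..<Suc m]" "x = c ! (\<theta> i - 1)"
    unfolding reindex_def set_map by blast
  with assms have "\<theta> i \<in> {1..length c}" by auto
  then show "x \<in> set c" using i by auto
qed

text \<open>Naturality in the letters. The range condition on \<open>\<theta>\<close> keeps every
  access inside \<open>c\<close>, where \<open>map\<close> commutes with \<open>!\<close>.\<close>

lemma map_reindex:
  assumes "\<theta> \<in> {1..m} \<rightarrow> {1..length c}"
  shows "map h (reindex c m \<theta>) = reindex (map h c) m \<theta>"
proof (rule nth_equalityI)
  fix j assume "j < length (map h (reindex c m \<theta>))"
  then have j: "j < m" by simp
  then have "\<theta> (Suc j) \<in> {1..length c}" using assms by auto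
  then have "\<theta> (Suc j) - 1 < length c" by auto
  then show "map h (reindex c m \<theta>) ! j = reindex (map h c) m \<theta> ! j"
    using j by (simp add: nth_reindex)
qed simp

text \<open>Contravariant functoriality: composing with \<open>f\<close> on the inside means reading
  the word obtained from \<open>g\<close> once more along \<open>f\<close>.\<close>

lemma reindex_compose:
  assumes "f \<in> {1..l} \<rightarrow> {1..m}"
  shows "reindex c l (compose {1..l} g f) = reindex (reindex c m g) l f"
proof (rule nth_equalityI)
  fix j assume "j < length (reindex c l (compose {1..l} g f))"
  then have j: "j < l" by simp
  then have "f (Suc j) \<in> {1..m}" using assms by auto
  then have "f (Suc j) - 1 < m" "Suc (f (Suc j) - 1) = f (Suc j)" by auto
  then show "reindex c l (compose {1..l} g f) ! j = reindex (reindex c m g) l f ! j"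
    using j by (simp add: nth_reindex compose_def)
qed simp

lemma reindex_id: "reindex c (length c) (\<lambda>x\<in>{1..length c}. x) = c"
  by (rule nth_equalityI) (auto simp: nth_reindex)

text \<open>In a word without repetitions a letter determines its position, so the word read off
  determines the function on its domain; extensionality settles the rest.\<close>

lemma reindex_inject:
  assumes "distinct c" "\<theta> \<in> {1..m} \<rightarrow>\<^sub>E {1..length c}" "\<phi> \<in> {1..m} \<rightarrow>\<^sub>E {1..length c}"
    and eq: "reindex c m \<theta> = reindex c m \<phi>"
  shows "\<theta> = \<phi>"
proof (rule PiE_ext)
  fix i assume i: "i \<in> {1..m}"
  then have "reindex c m \<theta> ! (i - 1) = reindex c m \<phi> ! (i - 1)" using eq by simp
  then have e: "c ! (\<theta> i - 1) = c ! (\<phi> i - 1)" using i by (cases i) (simp_all add: nth_reindex)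
  have r: "\<theta> i \<in> {1..length c}" "\<phi> i \<in> {1..length c}" using assms i by auto
  then have "\<theta> i - 1 = \<phi> i - 1"
    using e assms(1) by (subst (asm) nth_eq_iff_index_eq) auto
  \<comment> \<open>Both values are at least 1, so the truncated subtraction of 1 can be
    cancelled.\<close>
  then show "\<theta> i = \<phi> i" using r by auto
qed (use assms in auto)

text \<open>For each position of \<open>v\<close>, choose a position of \<open>c\<close> that
  carries the same letter.\<close>

lemma reindex_surj:
  assumes "set v \<subseteq> set c"
  obtains \<theta> where "\<theta> \<in> {1..length v} \<rightarrow>\<^sub>E {1..length c}" "v = reindex c (length v) \<theta>"
proof -
  have "\<forall>i\<in>{1..length v}. \<exists>j<length c. c ! j = v ! (i - 1)"
  proof
    fix i assume "i \<in> {1..length v}"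
    then have "v ! (i - 1) \<in> set v" by (intro nth_mem) auto
    then show "\<exists>j<length c. c ! j = v ! (i - 1)"
      using assms by (auto simp: subset_iff in_set_conv_nth)
  qed
  then obtain g where g: "\<forall>i\<in>{1..length v}. g i < length c \<and> c ! g i = v ! (i - 1)"
    by metis
  define \<theta> where "\<theta> = (\<lambda>i\<in>{1..length v}. Suc (g i))"
  show thesis
  proof
    show "\<theta> \<in> {1..length v} \<rightarrow>\<^sub>E {1..length c}"
      using g by (auto simp: \<theta>_def Suc_le_eq)
    show "v = reindex c (length v) \<theta>"
      by (rule nth_equalityI) (use g in \<open>auto simp: nth_reindex \<theta>_def\<close>)
  qed
qed

section \<open>Block decomposition of positions and words\<close>

lemma psum_Suc: "psum k (Suc i) = psum k i + k (Suc i)"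
  using psum_step[of "Suc i" k] by simp

lemma psum_0 [simp]: "psum k 0 = 0"
  by (simp add: psum_def)

text \<open>Induction on the number of blocks: either \<open>y\<close> lies within the first
  \<open>k\<close> blocks, or its offset is measured from their end. This gives existence, while
  \<open>block_eq\<close> gives uniqueness of the block.\<close>

lemma position_decomp:
  assumes "y \<in> {1..psum m k}"
  obtains i x where "i \<in> {1..k}" "0 < x" "x \<le> m i" "y = psum m (i - 1) + x"
proof -
  have "\<exists>i x. i \<in> {1..k} \<and> 0 < x \<and> x \<le> m i \<and> y = psum m (i - 1) + x"
    using assms
  proof (induction k)
    case (Suc k)
    show ?case
    proof (cases "y \<le> psum m k")
      case True
      then show ?thesis using Suc by fastforce
    next
      case False
      show ?thesis
        by (rule exI[of _ "Suc k"], rule exI[of _ "y - psum m k"])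
          (use False Suc.prems in \<open>auto simp: psum_Suc\<close>)
    qed
  qed simp
  then show thesis using that by blast
qed

text \<open>The positions split into consecutive intervals, each shifted back to start at 1. This
  allows identities about coproducts and similarity components to be checked one block at a
  time.\<close>

lemma map_upt_blocks:
  "map F [1..<Suc (psum m k)] =
     concat (map (\<lambda>i. map (\<lambda>x. F (psum m (i - 1) + x)) [1..<Suc (m i)]) [1..<Suc k])"
proof (induction k)
  case (Suc k)
  have s: "map F [Suc a..<Suc (a + b)] = map (\<lambda>x. F (a + x)) [1..<Suc b]" for a b
    by (rule nth_equalityI) (simp_all del: upt_Suc)
  have "[1..<Suc (psum m (Suc k))] =
      [1..<Suc (psum m k)] @ [Suc (psum m k)..<Suc (psum m k + m (Suc k))]"
    by (metis One_nat_def add_Suc le_add1 plus_1_eq_Suc psum_Suc upt_add_eq_append)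
  moreover have "[1..<Suc (Suc k)] = [1..<Suc k] @ [Suc k]" by simp
  ultimately show ?case using Suc by (simp only: map_append s concat_append) simp
qed simp

lemma length_concat_psum:
  assumes "\<And>i. i \<in> {1..length us} \<Longrightarrow> n i = length (us ! (i - 1))"
  shows "length (concat us) = psum n (length us)"
  using assms
proof (induction us rule: rev_induct)
  case (snoc u us)
  have "length (concat us) = psum n (length us)"
  proof (rule snoc.IH)
    fix i assume "i \<in> {1..length us}"
    then show "n i = length (us ! (i - 1))"
      using snoc.prems[of i] by (auto simp: nth_append)
  qed
  then show ?case using snoc.prems[of "Suc (length us)"] by (simp add: psum_Suc)
qed simp

text \<open>Induction from the right, since appending a word leaves the starting points of all
  earlier blocks unchanged. Both \<open>i\<close> and \<open>x\<close> count from 1.\<close>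

lemma nth_concat_psum:
  assumes "\<And>i. i \<in> {1..length us} \<Longrightarrow> n i = length (us ! (i - 1))"
    and "i \<in> {1..length us}" "0 < x" "x \<le> n i"
  shows "concat us ! (psum n (i - 1) + x - 1) = us ! (i - 1) ! (x - 1)"
  using assms
proof (induction us rule: rev_induct)
  case (snoc u us)
  have n: "n i = length (us ! (i - 1))" if "i \<in> {1..length us}" for i
    using snoc.prems(1)[of i] that by (auto simp: nth_append)
  have len: "length (concat us) = psum n (length us)"
    by (rule length_concat_psum) (rule n)
  show ?case
  proof (cases "i \<in> {1..length us}")
    case True
    have "psum n (i - 1) + x - 1 < length (concat us)"
      using position_in_range[OF True, of x n] snoc.prems len by auto
    then show ?thesis
      using snoc.IH[OF n True] snoc.prems True by (auto simp: nth_append)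
  next
    case False
    then have "i = Suc (length us)" using snoc.prems by auto
    moreover from this have "psum n (i - 1) + x - 1 = length (concat us) + (x - 1)"
      using snoc.prems len by simp
    ultimately show ?thesis by (simp add: nth_append)
  qed
qed simp

text \<open>The blocks of \<open>map_upt_blocks\<close>, applied to the function reading the letters
  of \<open>c\<close>, are the required pieces.\<close>

lemma split_word:
  assumes "length c = psum n k"
  obtains us where "length us = k" "concat us = c"
    "\<And>i. i \<in> {1..k} \<Longrightarrow> n i = length (us ! (i - 1))"
proof
  let ?us = "map (\<lambda>i. map (\<lambda>x. c ! (psum n (i - 1) + x - 1)) [1..<Suc (n i)]) [1..<Suc k]"
  show "length ?us = k" by simp
  have "c = map (\<lambda>y. c ! (y - 1)) [1..<Suc (length c)]"
    by (rule nth_equalityI) (simp_all del: upt_Suc)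
  then show "concat ?us = c"
    using map_upt_blocks[of "\<lambda>y. c ! (y - 1)" n k] assms by simp
  show "n i = length (?us ! (i - 1))" if "i \<in> {1..k}" for i
    using that by (cases i) (simp_all del: upt_Suc)
qed

section \<open>Action of coproducts and similarity components on words\<close>

text \<open>On block \<open>i\<close> of the domain the coproduct is \<open>f i\<close> shifted to
  the start of the word \<open>us ! (i - 1)\<close> in the concatenation, so that block reads only
  letters of this word.\<close>

lemma reindex_coproduct:
  assumes len: "\<And>i. i \<in> {1..length us} \<Longrightarrow> n i = length (us ! (i - 1))"
    and f: "\<And>i. i \<in> {1..length us} \<Longrightarrow> f i \<in> {1..m i} \<rightarrow> {1..n i}"
  shows "reindex (concat us) (psum m (length us)) (coproduct (length us) m n f) =
    concat (map (\<lambda>i. reindex (us ! (i - 1)) (m i) (f i)) [1..<Suc (length us)])"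
  unfolding reindex_def map_upt_blocks
proof (intro arg_cong[where f = concat] map_cong refl)
  fix i x assume "i \<in> set [1..<Suc (length us)]" "x \<in> set [1..<Suc (m i)]"
  then have i: "i \<in> {1..length us}" and x: "0 < x" "x \<le> m i" by auto
  have "f i x \<in> {1..n i}" using f[OF i] x by auto
  then show "concat us ! (coproduct (length us) m n f (psum m (i - 1) + x) - 1) =
      us ! (i - 1) ! (f i x - 1)"
    using nth_concat_psum[OF len i, of "f i x"] coproduct_apply[where m = m, OF i x, of n f] by simp
qed

text \<open>The similarity component carries block \<open>i\<close> identically onto block
  \<open>\<theta> i\<close>, so it reads off the whole word with that number. On the right,
  \<open>reindex\<close> permutes, repeats or omits words instead of letters.\<close>

lemma reindex_similarity:
  assumes len: "\<And>i. i \<in> {1..length us} \<Longrightarrow> k i = length (us ! (i - 1))"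
    and \<theta>: "\<theta> \<in> {1..m} \<rightarrow> {1..length us}"
  shows "reindex (concat us) (psum (k \<circ> \<theta>) m) (similarity m \<theta> k) = concat (reindex us m \<theta>)"
proof -
  have "map (\<lambda>y. concat us ! (similarity m \<theta> k y - 1)) [1..<Suc (psum (k \<circ> \<theta>) m)] =
      concat (map (\<lambda>i. us ! (\<theta> i - 1)) [1..<Suc m])"
    unfolding map_upt_blocks
  proof (intro arg_cong[where f = concat] map_cong refl)
    fix i assume "i \<in> set [1..<Suc m]"
    then have i: "i \<in> {1..m}" by auto
    then have \<theta>i: "\<theta> i \<in> {1..length us}" using \<theta> by auto
    show "map (\<lambda>x. concat us ! (similarity m \<theta> k (psum (k \<circ> \<theta>) (i - 1) + x) - 1))
        [1..<Suc ((k \<circ> \<theta>) i)] = us ! (\<theta> i - 1)"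
    proof (rule nth_equalityI)
      fix j assume "j < length (map (\<lambda>x. concat us !
        (similarity m \<theta> k (psum (k \<circ> \<theta>) (i - 1) + x) - 1)) [1..<Suc ((k \<circ> \<theta>) i)])"
      then have j: "Suc j \<le> k (\<theta> i)" by (simp del: upt_Suc)
      then show "map (\<lambda>x. concat us ! (similarity m \<theta> k (psum (k \<circ> \<theta>) (i - 1) + x) - 1))
          [1..<Suc ((k \<circ> \<theta>) i)] ! j = us ! (\<theta> i - 1) ! j"
        using nth_concat_psum[OF len \<theta>i _ j] similarity_apply[where k = k and \<theta> = \<theta> and x = "Suc j", OF i _ j]
        by (simp del: upt_Suc)
    qed (use len[OF \<theta>i] in \<open>simp del: upt_Suc\<close>)
  qed
  then show ?thesis by (simp add: reindex_def)
qed

lemma coproduct_PiE: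
  assumes "\<And>i. i \<in> {1..k} \<Longrightarrow> f i \<in> {1..m i} \<rightarrow> {1..n i}"
  shows "coproduct k m n f \<in> {1..psum m k} \<rightarrow>\<^sub>E {1..psum n k}"
proof (rule PiE_I)
  fix y assume "y \<in> {1..psum m k}"
  then obtain i x where y: "i \<in> {1..k}" "0 < x" "x \<le> m i" "y = psum m (i - 1) + x"
    by (rule position_decomp)
  then have "f i x \<in> {1..n i}" using assms by force
  then show "coproduct k m n f y \<in> {1..psum n k}"
    using y position_in_range[of i k "f i x" n] coproduct_apply[of i k x m n f] by simp
qed (auto simp: coproduct_def)

lemma similarity_PiE:
  assumes "\<theta> \<in> {1..m} \<rightarrow> {1..n}"
  shows "similarity m \<theta> k \<in> {1..psum (k \<circ> \<theta>) m} \<rightarrow>\<^sub>E {1..psum k n}"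
proof (rule PiE_I)
  fix y assume "y \<in> {1..psum (k \<circ> \<theta>) m}"
  then obtain i x where y: "i \<in> {1..m}" "0 < x" "x \<le> k (\<theta> i)" "y = psum (k \<circ> \<theta>) (i - 1) + x"
    by (rule position_decomp) auto
  then have "\<theta> i \<in> {1..n}" using assms by auto
  then show "similarity m \<theta> k y \<in> {1..psum k n}"
    using y position_in_range[of "\<theta> i" n x k] similarity_apply[of i m x k \<theta>] by simp
qed (auto simp: similarity_def)

section \<open>Contexts of given length and the axioms as rules\<close>

text \<open>This is where the infinitude of \<open>V\<close> enters: every object of the category is
  the length of some context.\<close>

lemma ex_context:
  assumes "infinite V"
  obtains c where "c \<in> contexts V" "length c = n"
proof -
  obtain A where A: "A \<subseteq> V" "finite A" "card A = n"
    using infinite_arbitrarily_large[OF assms] by blast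
  then obtain c where "set c = A" "distinct c" using finite_distinct_list by blast
  then have "c \<in> contexts V" "length c = n"
    using A by (auto simp: contexts_def distinct_card)
  then show thesis by (rule that)
qed

lemma Delta_iff:
  "(m, n, \<theta>) \<in> Delta V R \<longleftrightarrow> \<theta> \<in> {1..m} \<rightarrow>\<^sub>E {1..n} \<and>
     (\<exists>c\<in>contexts V. length c = n \<and> (c, reindex c m \<theta>) \<in> R)"
  by (simp add: Delta_def FinOrd_def reindex_def)

lemma context_structureD:
  assumes "context_structure V R"
  shows "(c, v) \<in> R \<Longrightarrow> c \<in> contexts V" "(c, v) \<in> R \<Longrightarrow> v \<in> lists V"
    and "c \<in> contexts V \<Longrightarrow> (c, c) \<in> R"
    and "(c, v) \<in> R \<Longrightarrow> set v \<subseteq> set c"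
    and "(c, concat vs) \<in> R \<Longrightarrow> list_all2 (\<lambda>v w. (v, w) \<in> R) vs ws \<Longrightarrow> (c, concat ws) \<in> R"
    and "(c, v) \<in> R \<Longrightarrow> s \<in> set c \<rightarrow> lists V \<Longrightarrow> (d, concat (map s c)) \<in> R \<Longrightarrow>
      (d, concat (map s v)) \<in> R"
  using assms unfolding context_structure_def by blast+

lemma structure_categoryD:
  assumes "structure_category D"
  shows "(m, n, \<theta>) \<in> D \<Longrightarrow> \<theta> \<in> {1..m} \<rightarrow>\<^sub>E {1..n}"
    and "(n, n, \<lambda>x\<in>{1..n}. x) \<in> D"
    and "(l, m, f) \<in> D \<Longrightarrow> (m, n, g) \<in> D \<Longrightarrow> (l, n, compose {1..l} g f) \<in> D"
    and "(\<And>i. i \<in> {1..k} \<Longrightarrow> (ms i, ns i, fs i) \<in> D) \<Longrightarrow>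
      (psum ms k, psum ns k, coproduct k ms ns fs) \<in> D"
    and "(m, n, \<theta>) \<in> D \<Longrightarrow> (psum (h \<circ> \<theta>) m, psum h n, similarity m \<theta> h) \<in> D"
  using assms unfolding structure_category_def FinOrd_def by blast+

section \<open>Recovering a context structure from its category\<close>

text \<open>Clause (4), with the letters of the context witnessing \<open>\<theta>\<close> replaced
  by the words \<open>us\<close>. The conclusion no longer mentions that context, which makes its
  choice immaterial.\<close>

lemma Delta_substitute:
  assumes R: "context_structure V R" and \<theta>: "(m, length us, \<theta>) \<in> Delta V R"
    and us: "set us \<subseteq> lists V" and d: "(d, concat us) \<in> R"
  shows "(d, concat (reindex us m \<theta>)) \<in> R"
proof -
  obtain c where c: "c \<in> contexts V" "length c = length us" "(c, reindex c m \<theta>) \<in> R"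
    and \<theta>': "\<theta> \<in> {1..m} \<rightarrow> {1..length c}"
    using \<theta> by (auto simp: Delta_iff)
  \<comment> \<open>The substitution sends the letter number \<open>i\<close> of \<open>c\<close> to
    the word number \<open>i\<close> of \<open>us\<close>; this is consistent because
    \<open>c\<close> has no repetitions.\<close>
  define s where "s = the \<circ> map_of (zip c us)"
  have dc: "distinct c" using c by (simp add: contexts_def)
  have s: "map s c = us"
    by (rule nth_equalityI) (use c dc in \<open>simp_all add: s_def map_of_zip_nth\<close>)
  then have "s ` set c = set us" by (metis set_map)
  then have "s \<in> set c \<rightarrow> lists V" using us by blast
  then have "(d, concat (map s (reindex c m \<theta>))) \<in> R"
    using context_structureD(6)[OF R c(3)] d s by simp
  then show ?thesis by (simp only: map_reindex[OF \<theta>'] s)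
qed

text \<open>The case of one-letter words. Since \<open>v\<close> may repeat letters, this also
  yields closure under composition; with \<open>v = d\<close> it moves a morphism to any context of
  the right length.\<close>

lemma Delta_substitute_letters:
  assumes R: "context_structure V R" and \<theta>: "(m, length v, \<theta>) \<in> Delta V R"
    and d: "(d, v) \<in> R"
  shows "(d, reindex v m \<theta>) \<in> R"
proof -
  have "v \<in> lists V" using context_structureD(2)[OF R d] .
  \<comment> \<open>Each letter is wrapped as a word of length one; naturality and
    \<open>concat\<close> remove the wrapping afterwards.\<close>
  then have "(d, concat (reindex (map (\<lambda>x. [x]) v) m \<theta>)) \<in> R"
    using \<theta> d by (intro Delta_substitute[OF R]) auto
  moreover have "\<theta> \<in> {1..m} \<rightarrow> {1..length v}" using \<theta> by (auto simp: Delta_iff)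
  ultimately show ?thesis by (simp flip: map_reindex)
qed

text \<open>Forwards, \<open>c\<close> itself witnesses membership of the function reading off
  \<open>v\<close>. Backwards, the function is applied to the word \<open>c\<close> in
  \<open>(c, c) \<in> R\<close>. Injectivity follows, as the right-hand side depends on
  \<open>R\<close> only through \<open>Delta V R\<close>.\<close>

lemma context_structure_iff_Delta:
  assumes R: "context_structure V R"
  shows "(c, v) \<in> R \<longleftrightarrow> c \<in> contexts V \<and>
    (\<exists>m \<theta>. (m, length c, \<theta>) \<in> Delta V R \<and> v = reindex c m \<theta>)"
proof
  assume cv: "(c, v) \<in> R"
  note c = context_structureD(1)[OF R cv]
  obtain \<theta> where "\<theta> \<in> {1..length v} \<rightarrow>\<^sub>E {1..length c}" "v = reindex c (length v) \<theta>"
    using reindex_surj[OF context_structureD(4)[OF R cv]] .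
  then show "c \<in> contexts V \<and> (\<exists>m \<theta>. (m, length c, \<theta>) \<in> Delta V R \<and> v = reindex c m \<theta>)"
    using cv c by (metis Delta_iff)
next
  assume "c \<in> contexts V \<and> (\<exists>m \<theta>. (m, length c, \<theta>) \<in> Delta V R \<and> v = reindex c m \<theta>)"
  then show "(c, v) \<in> R"
    using Delta_substitute_letters[OF R] context_structureD(3)[OF R] by blast
qed

lemma inj_on_Delta: "inj_on (Delta V) {R. context_structure V R}"
proof (rule inj_onI)
  fix R S assume "R \<in> {R. context_structure V R}" "S \<in> {R. context_structure V R}"
    and eq: "Delta V R = Delta V S"
  then have R: "context_structure V R" and S: "context_structure V S" by auto
  have "(c, v) \<in> R \<longleftrightarrow> (c, v) \<in> S" for c v
    by (simp only: context_structure_iff_Delta[OF R] context_structure_iff_Delta[OF S] eq)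
  then show "R = S" by auto
qed

section \<open>The category of a context structure\<close>

text \<open>Identities come from clause (1), composites from substitution of letters, coproducts
  from clause (3) and similarity components from clause (4).\<close>

lemma structure_category_Delta:
  assumes V: "infinite V" and R: "context_structure V R"
  shows "structure_category (Delta V R)"
  unfolding structure_category_def
proof (intro conjI allI impI)
  show "Delta V R \<subseteq> FinOrd" by (auto simp: Delta_def)
next
  fix n
  obtain c where c: "c \<in> contexts V" "length c = n" using ex_context[OF V] .
  then show "(n, n, \<lambda>x\<in>{1..n}. x) \<in> Delta V R"
    unfolding Delta_iff using context_structureD(3)[OF R c(1)] reindex_id[of c] by auto
next
  fix l m n f g
  assume f: "(l, m, f) \<in> Delta V R" and g: "(m, n, g) \<in> Delta V R"
  then have fg: "f \<in> {1..l} \<rightarrow>\<^sub>E {1..m}" "g \<in> {1..m} \<rightarrow>\<^sub>E {1..n}" by (auto simp: Delta_iff)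
  obtain c where c: "c \<in> contexts V" "length c = n" "(c, reindex c m g) \<in> R"
    using g by (auto simp: Delta_iff)
  \<comment> \<open>The morphism \<open>f\<close> acts on the word that \<open>g\<close> reads off
    from \<open>c\<close>.\<close>
  have "(c, reindex c l (compose {1..l} g f)) \<in> R"
    using Delta_substitute_letters[OF R _ c(3)] f fg by (subst reindex_compose) auto
  moreover have "compose {1..l} g f \<in> {1..l} \<rightarrow>\<^sub>E {1..n}"
    using fg by (auto simp: compose_def)
  ultimately show "(l, n, compose {1..l} g f) \<in> Delta V R"
    using c by (auto simp: Delta_iff)
next
  fix k :: nat and m n f
  assume f: "\<forall>i\<in>{1..k}. (m i, n i, f i) \<in> Delta V R"
  then have f': "f i \<in> {1..m i} \<rightarrow> {1..n i}" if "i \<in> {1..k}" for i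
    using that by (auto simp: Delta_iff)
  \<comment> \<open>A context for the codomain of the coproduct is cut into pieces of lengths
    \<open>n i\<close>. Each piece is a context, so \<open>f i\<close> acts on it, and clause (3)
    replaces all pieces simultaneously.\<close>
  obtain c where c: "c \<in> contexts V" "length c = psum n k" using ex_context[OF V] .
  obtain us where us: "length us = k" "concat us = c"
    "\<And>i. i \<in> {1..k} \<Longrightarrow> n i = length (us ! (i - 1))"
    by (rule split_word[OF c(2)]) blast
  have usV: "u \<in> contexts V" if "u \<in> set us" for u
    using that c us(2) by (auto simp: contexts_def distinct_concat_iff)
  let ?ws = "map (\<lambda>i. reindex (us ! (i - 1)) (m i) (f i)) [1..<Suc (length us)]"
  have "list_all2 (\<lambda>v w. (v, w) \<in> R) us ?ws"
  proof (rule list_all2_all_nthI)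
    fix j assume j: "j < length us"
    then have i: "Suc j \<in> {1..k}" using us(1) by auto
    have "(us ! j, us ! j) \<in> R" using context_structureD(3)[OF R usV] j by simp
    moreover have "(m (Suc j), length (us ! j), f (Suc j)) \<in> Delta V R"
      using f[rule_format, OF i] us(3)[OF i] by simp
    ultimately show "(us ! j, ?ws ! j) \<in> R"
      using j Delta_substitute_letters[OF R] by (simp del: upt_Suc)
  qed (simp del: upt_Suc)
  then have "(c, concat ?ws) \<in> R"
    using context_structureD(5)[OF R, of c us] context_structureD(3)[OF R c(1)] us(2) by simp
  then have "(c, reindex c (psum m k) (coproduct k m n f)) \<in> R"
    using reindex_coproduct[of us n f m] us f' by simp
  then show "(psum m k, psum n k, coproduct k m n f) \<in> Delta V R"
    using c coproduct_PiE[of k f m n] f' by (auto simp: Delta_iff)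
next
  fix m n \<theta> k
  assume \<theta>: "(m, n, \<theta>) \<in> Delta V R"
  then have \<theta>': "\<theta> \<in> {1..m} \<rightarrow> {1..n}" by (auto simp: Delta_iff)
  \<comment> \<open>The pieces of this context, of lengths \<open>k i\<close>, are the words to be
    substituted into \<open>\<theta>\<close>.\<close>
  obtain c where c: "c \<in> contexts V" "length c = psum k n" using ex_context[OF V] .
  obtain us where us: "length us = n" "concat us = c"
    "\<And>i. i \<in> {1..n} \<Longrightarrow> k i = length (us ! (i - 1))"
    by (rule split_word[OF c(2)]) blast
  have "set us \<subseteq> lists V" using c us(2) by (auto simp: contexts_def)
  then have "(c, concat (reindex us m \<theta>)) \<in> R"
    using Delta_substitute[OF R, of m us \<theta> c] \<theta> us context_structureD(3)[OF R c(1)] by simp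
  then have "(c, reindex c (psum (k \<circ> \<theta>) m) (similarity m \<theta> k)) \<in> R"
    using reindex_similarity[of us k \<theta> m] us \<theta>' by simp
  then show "(psum (k \<circ> \<theta>) m, psum k n, similarity m \<theta> k) \<in> Delta V R"
    using c similarity_PiE[OF \<theta>', of k] by (auto simp: Delta_iff)
qed

section \<open>The inverse construction\<close>

text \<open>The candidate preimage of \<open>D\<close>, dictated by
  \<open>context_structure_iff_Delta\<close>.\<close>

definition induced_relation :: "'a set \<Rightarrow> morphism set \<Rightarrow> ('a list \<times> 'a list) set" where
  "induced_relation V D =
     {(c, v). c \<in> contexts V \<and> (\<exists>m \<theta>. (m, length c, \<theta>) \<in> D \<and> v = reindex c m \<theta>)}"

text \<open>Clause (1) comes from identities and clause (2) from the range of a morphism. For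
  clauses (3) and (4) the given witness is precomposed with a coproduct or a similarity
  component.\<close>

lemma context_structure_induced_relation:
  assumes D: "structure_category D"
  shows "context_structure V (induced_relation V D)"
proof -
  let ?R = "induced_relation V D"
  have sub: "set v \<subseteq> set c" if cv: "(c, v) \<in> ?R" for c v
  proof -
    obtain m \<theta> where \<theta>: "(m, length c, \<theta>) \<in> D" "v = reindex c m \<theta>"
      using cv by (auto simp: induced_relation_def)
    then have "\<theta> \<in> {1..m} \<rightarrow> {1..length c}"
      using structure_categoryD(1)[OF D] by (auto simp: PiE_def)
    then show ?thesis using set_reindex \<theta>(2) by blast
  qed
  have "?R \<subseteq> contexts V \<times> lists V"
    using sub by (fastforce simp: induced_relation_def contexts_def)
  moreover have "(c, c) \<in> ?R" if "c \<in> contexts V" for c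
    using that structure_categoryD(2)[OF D, of "length c"] reindex_id[of c]
    unfolding induced_relation_def by force
  moreover have "(c, concat ws) \<in> ?R"
    if cv: "(c, concat vs) \<in> ?R" and vw: "list_all2 (\<lambda>v w. (v, w) \<in> ?R) vs ws" for c vs ws
  proof -
    obtain l \<theta> where \<theta>: "c \<in> contexts V" "(l, length c, \<theta>) \<in> D" "concat vs = reindex c l \<theta>"
      using cv by (auto simp: induced_relation_def)
    define n where "n i = length (vs ! (i - 1))" for i :: nat
    have "\<forall>i\<in>{1..length vs}. \<exists>m f. (m, n i, f) \<in> D \<and> ws ! (i - 1) = reindex (vs ! (i - 1)) m f"
    proof
      fix i assume "i \<in> {1..length vs}"
      then have "(vs ! (i - 1), ws ! (i - 1)) \<in> ?R" using vw by (auto simp: list_all2_conv_all_nth)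
      then show "\<exists>m f. (m, n i, f) \<in> D \<and> ws ! (i - 1) = reindex (vs ! (i - 1)) m f"
        by (auto simp: induced_relation_def n_def)
    qed
    then obtain m f where mf: "\<And>i. i \<in> {1..length vs} \<Longrightarrow>
        (m i, n i, f i) \<in> D \<and> ws ! (i - 1) = reindex (vs ! (i - 1)) (m i) (f i)"
      by metis
    let ?k = "length vs" and ?F = "coproduct (length vs) m n f"
    have f: "f i \<in> {1..m i} \<rightarrow> {1..n i}" if "i \<in> {1..?k}" for i
      using structure_categoryD(1)[OF D] mf[OF that] by (auto simp: PiE_def)
    \<comment> \<open>The codomain of the coproduct and the domain of \<open>\<theta>\<close> agree,
      both being the length of \<open>concat vs\<close>; hence the two morphisms compose.\<close>
    have "psum n ?k = length (concat vs)" by (rule length_concat_psum[symmetric]) (simp add: n_def)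
    then have l: "psum n ?k = l" using \<theta> by simp
    have F: "(psum m ?k, l, ?F) \<in> D"
      using structure_categoryD(4)[OF D, of ?k m n f] mf l by auto
    have "ws = map (\<lambda>i. reindex (vs ! (i - 1)) (m i) (f i)) [1..<Suc ?k]"
    proof (rule nth_equalityI)
      show "length ws = length (map (\<lambda>i. reindex (vs ! (i - 1)) (m i) (f i)) [1..<Suc ?k])"
        using vw by (simp add: list_all2_lengthD del: upt_Suc)
      fix j assume "j < length ws"
      then have "j < ?k" using vw by (simp add: list_all2_lengthD)
      then show "ws ! j = map (\<lambda>i. reindex (vs ! (i - 1)) (m i) (f i)) [1..<Suc ?k] ! j"
        using mf[of "Suc j"] by (simp del: upt_Suc)
    qed
    then have "concat ws = reindex (concat vs) (psum m ?k) ?F"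
      using reindex_coproduct[of vs n f m] f by (simp add: n_def del: upt_Suc)
    also have "\<dots> = reindex c (psum m ?k) (compose {1..psum m ?k} \<theta> ?F)"
      using structure_categoryD(1)[OF D F] \<theta>(3) by (subst reindex_compose) (auto simp: PiE_def)
    finally show ?thesis
      using structure_categoryD(3)[OF D F \<theta>(2)] \<theta>(1) by (auto simp: induced_relation_def)
  qed
  moreover have "(d, concat (map s v)) \<in> ?R"
    if cv: "(c, v) \<in> ?R" and ds: "(d, concat (map s c)) \<in> ?R" for c v d and s :: "'a \<Rightarrow> 'a list"
  proof -
    obtain m \<theta> where \<theta>: "c \<in> contexts V" "(m, length c, \<theta>) \<in> D" "v = reindex c m \<theta>"
      using cv by (auto simp: induced_relation_def)
    obtain l \<phi> where \<phi>: "d \<in> contexts V" "(l, length d, \<phi>) \<in> D" "concat (map s c) = reindex d l \<phi>"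
      using ds by (auto simp: induced_relation_def)
    have \<theta>': "\<theta> \<in> {1..m} \<rightarrow> {1..length c}"
      using structure_categoryD(1)[OF D \<theta>(2)] by (simp add: PiE_def)
    \<comment> \<open>With the lengths of the substituted words as block sizes, the similarity
      component ends at the length of \<open>concat (map s c)\<close>, which is the domain
      \<open>l\<close> of \<open>\<phi>\<close>.\<close>
    define k where "k i = length (map s c ! (i - 1))" for i :: nat
    let ?M = "psum (k \<circ> \<theta>) m" and ?F = "similarity m \<theta> k"
    have "psum k (length (map s c)) = length (concat (map s c))"
      by (rule length_concat_psum[symmetric]) (simp add: k_def)
    then have l: "psum k (length c) = l" using \<phi> by simp
    have F: "(?M, l, ?F) \<in> D" using structure_categoryD(5)[OF D \<theta>(2), of k] l by simp
    have "concat (map s v) = concat (reindex (map s c) m \<theta>)"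
      by (simp only: \<theta>(3) map_reindex[OF \<theta>'])
    also have "\<dots> = reindex (concat (map s c)) ?M ?F"
      using \<theta>' by (intro reindex_similarity[symmetric]) (auto simp: k_def)
    also have "\<dots> = reindex d ?M (compose {1..?M} \<phi> ?F)"
      using structure_categoryD(1)[OF D F] \<phi>(3) by (subst reindex_compose) (auto simp: PiE_def)
    finally show ?thesis
      using structure_categoryD(3)[OF D F \<phi>(2)] \<phi>(1) by (auto simp: induced_relation_def)
  qed
  ultimately show ?thesis unfolding context_structure_def using sub by blast
qed

text \<open>A member of the left-hand side reads the same word from a context as some morphism of
  \<open>D\<close>, and \<open>reindex_inject\<close> identifies the two. Conversely, any context of
  length \<open>n\<close> serves as witness.\<close>

lemma Delta_induced_relation:
  assumes V: "infinite V" and D: "structure_category D"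
  shows "Delta V (induced_relation V D) = D"
proof -
  have "(m, n, \<theta>) \<in> Delta V (induced_relation V D) \<longleftrightarrow> (m, n, \<theta>) \<in> D" for m n \<theta>
  proof
    assume "(m, n, \<theta>) \<in> Delta V (induced_relation V D)"
    then obtain c where \<theta>: "\<theta> \<in> {1..m} \<rightarrow>\<^sub>E {1..n}" and c: "c \<in> contexts V" "length c = n"
      and r: "(c, reindex c m \<theta>) \<in> induced_relation V D"
      by (auto simp: Delta_iff)
    then obtain m' \<phi> where \<phi>: "(m', n, \<phi>) \<in> D" "reindex c m \<theta> = reindex c m' \<phi>"
      by (auto simp: induced_relation_def)
    \<comment> \<open>The relation records only the word, so the domain of \<open>\<phi>\<close> is
      recovered from its length.\<close>
    have m: "m' = m" using arg_cong[OF \<phi>(2), of length] by simp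
    have "\<theta> = \<phi>"
      using reindex_inject[of c \<theta> m \<phi>] \<theta> \<phi> c structure_categoryD(1)[OF D \<phi>(1)] m
      by (simp add: contexts_def)
    then show "(m, n, \<theta>) \<in> D" using \<phi>(1) m by simp
  next
    assume \<theta>: "(m, n, \<theta>) \<in> D"
    obtain c where "c \<in> contexts V" "length c = n" using ex_context[OF V] .
    then show "(m, n, \<theta>) \<in> Delta V (induced_relation V D)"
      using \<theta> structure_categoryD(1)[OF D \<theta>] unfolding Delta_iff induced_relation_def by blast
  qed
  then show ?thesis by auto
qed

theorem theorem3p4:
  fixes V :: "'a set"
  assumes "infinite V"
  shows "bij_betw (Delta V) {R. context_structure V R} {D. structure_category D}"
proof (rule bij_betw_imageI)
  show "inj_on (Delta V) {R. context_structure V R}" by (rule inj_on_Delta)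
  show "Delta V ` {R. context_structure V R} = {D. structure_category D}"
  proof (intro equalityI subsetI)
    fix D assume "D \<in> Delta V ` {R. context_structure V R}"
    then show "D \<in> {D. structure_category D}" using structure_category_Delta[OF assms] by auto
  next
    fix D assume "D \<in> {D. structure_category D}"
    then show "D \<in> Delta V ` {R. context_structure V R}"
      using Delta_induced_relation[OF assms] context_structure_induced_relation
      by (metis image_eqI mem_Collect_eq)
  qed
qed

end
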